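(* For every complex number $q$ with $|q|<1$, $$\sum_{k=0}^\infty(-1)^k\frac{q^{2k}(1+q^{2k+1})}{(1-q^{2k+1})^3}=\frac{(q^2;q^4)_{\infty}^2\,(q^4;q^4)_{\infty}^6}{(q;q^2)_{\infty}^4}.$$
   Context: For complex numbers $a$ and $q$ with $|q|<1$, $(a;q)_\infty=\prod_{k=0}^\infty(1-aq^k)$; thus e.g. $(q^2;q^4)_\infty=\prod_{k=0}^\infty(1-q^{2+4k})$. The convention $q^0=1$ is used (also for $q=0$). *)

theory Defs
  imports "HOL-Analysis.Analysis"
begin

definition qpoch_inf :: "complex \<Rightarrow> complex \<Rightarrow> complex" where
  "qpoch_inf a q = (\<Prod>k. 1 - a * q ^ k)"

end

theory Submission
  imports Defs
begin

text \<open>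
  Put \<open>u\<^sub>k = x\<^bsup>2k+1\<^esup> + x\<^bsup>-2k-1\<^esup>\<close>. Differentiating the partial fraction expansion of the rational function
  \<open>\<Prod>\<^bsub>i<n\<^esub> (w + u\<^sub>i)/(w - u\<^sub>i)\<close> at \<open>w = 2\<close> expresses a finite form of the alternating sum as a product times
  a finite form of the Lambert sum \<open>\<Sum> Q\<^sup>k (1 + Q\<^bsup>2k+1\<^esup>)/(1 - Q\<^bsup>2k+1\<^esup>)\<^sup>2\<close> with \<open>Q = x\<^sup>2\<close>. The Lambert sum, with
  \<open>Q\<close> renamed to \<open>x\<close>, is evaluated by expanding \<open>\<Prod>\<^bsub>0<j<n\<^esub> (w - v\<^sub>j) / \<Prod>\<^bsub>k<n\<^esub> (w - u\<^sub>k)\<close> with \<open>v\<^sub>j = x\<^bsup>2j\<^esup> + x\<^bsup>-2j\<^esup>\<close> at \<open>w = 2\<close>; this is Jacobi's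
  formula for the fourth power of \<open>(x\<^sup>2;x\<^sup>2)\<^sub>\<infinity>/(x;x\<^sup>2)\<^sub>\<infinity>\<close>. Both finite identities pass to the limit
  by Tannery's theorem.
\<close>

subsection \<open>\<open>q\<close>-Pochhammer symbols\<close>

definition qpoch :: "complex \<Rightarrow> complex \<Rightarrow> nat \<Rightarrow> complex" where
  "qpoch a q n = (\<Prod>k<n. 1 - a * q ^ k)"

lemma qpoch_0 [simp]: "qpoch a q 0 = 1"
  by (simp add: qpoch_def)

lemma qpoch_Suc: "qpoch a q (Suc n) = qpoch a q n * (1 - a * q ^ n)"
  by (simp add: qpoch_def)

lemma one_minus_mult_power_nonzero:
  fixes a q :: complex
  assumes "norm a < 1" "norm q < 1"
  shows "1 - a * q ^ k \<noteq> 0"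
proof -
  have "norm (a * q ^ k) \<le> norm a * 1"
    unfolding norm_mult norm_power using assms by (intro mult_left_mono power_le_one) auto
  then show ?thesis
    using assms by auto
qed

lemma convergent_prod_qpoch:
  fixes a q :: complex
  assumes "norm q < 1"
  shows "convergent_prod (\<lambda>k. 1 - a * q ^ k)"
proof -
  have "summable (\<lambda>k. norm (1 - a * q ^ k - 1))"
    using assms by (simp add: norm_mult norm_power summable_mult summable_geometric)
  from abs_convergent_prod_imp_convergent_prod[OF summable_imp_abs_convergent_prod[OF this]]
  show ?thesis .
qed

lemma qpoch_LIMSEQ:
  assumes "norm q < 1"
  shows "qpoch a q \<longlonglongrightarrow> qpoch_inf a q"
  using convergent_prod_LIMSEQ[OF convergent_prod_qpoch[OF assms]]
  by (simp add: qpoch_def[abs_def] qpoch_inf_def LIMSEQ_lessThan_iff_atMost)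

lemma qpoch_inf_nonzero: "norm a < 1 \<Longrightarrow> norm q < 1 \<Longrightarrow> qpoch_inf a q \<noteq> 0"
  unfolding qpoch_inf_def
  by (intro prodinf_nonzero convergent_prod_qpoch one_minus_mult_power_nonzero)

lemma qpoch_inf_mult_uminus:
  assumes "norm q < 1"
  shows "qpoch_inf a q * qpoch_inf (- a) q = qpoch_inf (a\<^sup>2) (q\<^sup>2)"
proof (rule LIMSEQ_unique)
  have "norm (q\<^sup>2) < 1"
    using assms by (simp add: norm_power power_less_one_iff)
  then show "qpoch (a\<^sup>2) (q\<^sup>2) \<longlonglongrightarrow> qpoch_inf (a\<^sup>2) (q\<^sup>2)"
    by (rule qpoch_LIMSEQ)
  have "qpoch a q n * qpoch (- a) q n = qpoch (a\<^sup>2) (q\<^sup>2) n" for n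
    unfolding qpoch_def prod.distrib[symmetric]
    by (intro prod.cong) (simp_all add: power2_eq_square power_mult_distrib algebra_simps)
  then show "qpoch (a\<^sup>2) (q\<^sup>2) \<longlonglongrightarrow> qpoch_inf a q * qpoch_inf (- a) q"
    using tendsto_mult[OF qpoch_LIMSEQ[OF assms, of a] qpoch_LIMSEQ[OF assms, of "- a"]] by simp
qed

text \<open>The factors are sorted by the parity of the exponent of \<open>q\<close>:
  \<open>n\<close> factors of each kind are exactly the first \<open>2 * n\<close> factors on the
  left.\<close>

lemma qpoch_inf_bisect:
  assumes "norm q < 1"
  shows "qpoch_inf q q = qpoch_inf q (q\<^sup>2) * qpoch_inf (q\<^sup>2) (q\<^sup>2)"
proof (rule LIMSEQ_unique)
  have "norm (q\<^sup>2) < 1"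
    using assms by (simp add: norm_power power_less_one_iff)
  then have "(\<lambda>n. qpoch q (q\<^sup>2) n * qpoch (q\<^sup>2) (q\<^sup>2) n) \<longlonglongrightarrow> qpoch_inf q (q\<^sup>2) * qpoch_inf (q\<^sup>2) (q\<^sup>2)"
    by (intro tendsto_mult qpoch_LIMSEQ)
  moreover have "qpoch q (q\<^sup>2) n * qpoch (q\<^sup>2) (q\<^sup>2) n = qpoch q q (2 * n)" for n
    by (induction n) (simp_all add: qpoch_Suc mult_ac power2_eq_square power_mult_distrib power_mult)
  ultimately show "(\<lambda>n. qpoch q q (2 * n)) \<longlonglongrightarrow> qpoch_inf q (q\<^sup>2) * qpoch_inf (q\<^sup>2) (q\<^sup>2)"
    by simp
  show "(\<lambda>n. qpoch q q (2 * n)) \<longlonglongrightarrow> qpoch_inf q q"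
    using LIMSEQ_subseq_LIMSEQ[OF qpoch_LIMSEQ[OF assms, of q], of "\<lambda>n. 2 * n"]
    by (simp add: o_def strict_mono_def)
qed

subsection \<open>Partial fractions and Tannery's theorem\<close>

text \<open>Lagrange interpolation. Degree \<open>n\<close> is one more than \<open>n\<close> nodes
  determine; the coefficient of degree \<open>n\<close> supplies the missing condition and becomes
  the constant term.\<close>

lemma poly_partial_fractions:
  fixes u :: "nat \<Rightarrow> 'a::field"
  assumes u: "inj_on u {..<n}" and p: "degree p \<le> n" and w: "\<And>k. k < n \<Longrightarrow> w \<noteq> u k"
  shows "poly p w / (\<Prod>i<n. w - u i) =
    coeff p n + (\<Sum>k<n. poly p (u k) / (\<Prod>i\<in>{..<n} - {k}. u k - u i) / (w - u k))"
proof -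
  define L where "L k = (\<Prod>i\<in>{..<n} - {k}. [:- u i, 1:])" for k
  define c where "c k = poly p (u k) / (\<Prod>i\<in>{..<n} - {k}. u k - u i)" for k
  define M where "M = (\<Prod>i<n. [:- u i, 1:])"
  have deg_M: "degree M = n"
    unfolding M_def by (subst degree_prod_eq_sum_degree) auto
  have lead_M: "coeff M n = 1"
    using deg_M lead_coeff_prod[of "\<lambda>i. [:- u i, 1:]" "{..<n}"] by (simp add: M_def)
  have deg_L: "degree (L k) < n" if "k < n" for k
    using that unfolding L_def by (subst degree_prod_eq_sum_degree) auto
  \<comment> \<open>Both sides have degree at most \<open>n\<close>, the same coefficient there, and
    the same value at each node \<open>u j\<close>, where only the summand with \<open>L j\<close>
    survives.\<close>
  have "p = smult (coeff p n) M + (\<Sum>k<n. smult (c k) (L k))" (is "_ = ?r")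
  proof (rule poly_eqI_degree_lead_coeff[where n = n and A = "u ` {..<n}"])
    show "coeff p n = coeff ?r n"
      using deg_L by (simp add: coeff_sum lead_M coeff_eq_0)
    show "card (u ` {..<n}) \<ge> n"
      using u by (simp add: card_image)
    show "degree ?r \<le> n"
      using deg_L deg_M
      by (intro degree_add_le degree_sum_le) (auto intro!: order.trans[OF degree_smult_le] less_imp_le)
    fix z assume "z \<in> u ` {..<n}"
    then obtain j where j: "j < n" "z = u j" by auto
    have "c k * poly (L k) z = (if k = j then poly p z else 0)" if "k < n" for k
      using j that u
      by (auto simp: L_def poly_prod c_def inj_on_def)
    moreover have "poly M z = 0"
      using j by (auto simp: M_def poly_prod)
    ultimately show "poly p z = poly ?r z"
      using j by (simp add: poly_sum)
  qed (use p in auto)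
  then have "poly p w = poly ?r w"
    by simp
  then have "poly p w / (\<Prod>i<n. w - u i) =
      coeff p n * (poly M w / (\<Prod>i<n. w - u i)) + (\<Sum>k<n. c k * (poly (L k) w / (\<Prod>i<n. w - u i)))"
    by (simp add: poly_sum sum_divide_distrib add_divide_distrib)
  also have "poly M w / (\<Prod>i<n. w - u i) = 1"
    using w by (simp add: M_def poly_prod)
  also have "(\<Sum>k<n. c k * (poly (L k) w / (\<Prod>i<n. w - u i))) = (\<Sum>k<n. c k / (w - u k))"
  proof (rule sum.cong)
    fix k assume "k \<in> {..<n}"
    then have "(\<Prod>i<n. w - u i) = (w - u k) * poly (L k) w" "poly (L k) w \<noteq> 0"
      using w by (auto simp: L_def poly_prod prod.remove[of _ k])
    then show "c k * (poly (L k) w / (\<Prod>i<n. w - u i)) = c k / (w - u k)"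
      by simp
  qed simp
  finally show ?thesis
    by (simp add: c_def)
qed

text \<open>Both finite identities have a left side of this shape. For fixed \<open>k\<close> the
  two indices tend to infinity, so the weight tends to \<open>L\<^sup>2\<close>; boundedness of
  \<open>c\<close> gives a dominating series.\<close>

lemma tannery_convolution:
  fixes c t :: "nat \<Rightarrow> complex"
  assumes c: "c \<longlonglongrightarrow> L" and t: "summable (\<lambda>k. norm (t k))"
  shows "(\<lambda>n. \<Sum>k<n. c (n - 1 - k) * c (n + k) * t k) \<longlonglongrightarrow> L\<^sup>2 * suminf t"
proof -
  \<comment> \<open>Extension by zero turns a sum of varying length into a series over all
    \<open>k\<close>.\<close>
  define a where "a k n = (if k < n then c (n - 1 - k) * c (n + k) * t k else 0)" for k n
  obtain K where K: "\<And>n. norm (c n) \<le> K"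
    using convergent_imp_Bseq[OF convergentI[OF c]] unfolding Bseq_def by blast
  have K0: "K \<ge> 0"
    using order.trans[OF norm_ge_zero K[of 0]] .
  have lim: "a k \<longlonglongrightarrow> L\<^sup>2 * t k" for k
  proof (rule Lim_transform_eventually)
    \<comment> \<open>Shifting \<open>n\<close> by \<open>Suc k\<close> makes the truncated
      subtraction exact and leaves \<open>c n\<close>.\<close>
    have "(\<lambda>n. c (n - 1 - k)) \<longlonglongrightarrow> L"
      by (rule LIMSEQ_offset[of _ "Suc k"]) (use c in simp)
    moreover have "(\<lambda>n. c (n + k)) \<longlonglongrightarrow> L"
      using c by (rule LIMSEQ_ignore_initial_segment)
    ultimately show "(\<lambda>n. c (n - 1 - k) * c (n + k) * t k) \<longlonglongrightarrow> L\<^sup>2 * t k"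
      unfolding power2_eq_square by (intro tendsto_intros)
    show "\<forall>\<^sub>F n in sequentially. c (n - 1 - k) * c (n + k) * t k = a k n"
      using eventually_gt_at_top[of k] by eventually_elim (simp add: a_def)
  qed
  have "norm (a k n) \<le> K * K * norm (t k)" for k n
    using K K0 by (auto simp: a_def norm_mult intro!: mult_mono mult_nonneg_nonneg)
  then have "(\<lambda>n. suminf (\<lambda>k. a k n)) \<longlonglongrightarrow> suminf (\<lambda>k. L\<^sup>2 * t k)"
    using tannerys_theorem[of a "\<lambda>k. L\<^sup>2 * t k" sequentially "\<lambda>k. K * K * norm (t k)"] lim
      summable_mult[OF t]
    by (auto simp: eventually_True case_prod_unfold)
  moreover have "suminf (\<lambda>k. a k n) = (\<Sum>k<n. c (n - 1 - k) * c (n + k) * t k)" for n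
    by (subst suminf_finite[of "{..<n}"]) (auto simp: a_def)
  ultimately show ?thesis
    using summable_norm_cancel[OF t] by (simp add: suminf_mult)
qed

lemma summable_norm_power_mult:
  fixes x :: complex
  assumes "norm x < 1" "Bseq c"
  shows "summable (\<lambda>k. norm (x ^ k * c k))"
proof -
  obtain K where "\<And>n. norm (c n) \<le> K"
    using assms(2) unfolding Bseq_def by blast
  then have "norm (norm (x ^ k * c k)) \<le> norm x ^ k * K" for k
    by (simp add: norm_mult norm_power mult_left_mono)
  moreover have "summable (\<lambda>k. norm x ^ k * K)"
    using assms(1) by (intro summable_mult2 summable_geometric) simp
  ultimately show ?thesis
    using summable_comparison_test'[of "\<lambda>k. norm x ^ k * K" 0 "\<lambda>k. norm (x ^ k * c k)"] by simp
qed

subsection \<open>Residues at the nodes\<close>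

lemma power_neq_one_complex:
  fixes x :: complex
  assumes "norm x < 1" "m > 0"
  shows "x ^ m \<noteq> 1" "x ^ m \<noteq> -1"
proof -
  have "norm (x ^ m) < 1"
    using assms by (simp add: norm_power power_less_one_iff)
  then show "x ^ m \<noteq> 1" "x ^ m \<noteq> -1"
    by auto
qed

text \<open>For \<open>x\<close> on the unit circle this is twice the cosine of \<open>m\<close>
  times the argument of \<open>x\<close>.\<close>

definition node :: "complex \<Rightarrow> nat \<Rightarrow> complex" where
  "node x m = x ^ m + inverse (x ^ m)"

definition plus_ratio :: "complex \<Rightarrow> nat \<Rightarrow> complex" where
  "plus_ratio x m = qpoch (- x\<^sup>2) (x\<^sup>2) m / qpoch (x\<^sup>2) (x\<^sup>2) m"

text \<open>In base \<open>x\<^sup>2\<close> this is the q-analogue of the central binomial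
  coefficient divided by \<open>4 ^ m\<close>.\<close>

definition odd_ratio :: "complex \<Rightarrow> nat \<Rightarrow> complex" where
  "odd_ratio x m = qpoch x (x\<^sup>2) m / qpoch (x\<^sup>2) (x\<^sup>2) m"

lemma plus_ratio_0 [simp]: "plus_ratio x 0 = 1"
  by (simp add: plus_ratio_def)

lemma plus_ratio_Suc: "plus_ratio x (Suc m) = plus_ratio x m * ((1 + x ^ (2 * Suc m)) / (1 - x ^ (2 * Suc m)))"
  by (simp add: plus_ratio_def qpoch_Suc power2_eq_square power_mult mult.assoc)

lemma odd_ratio_0 [simp]: "odd_ratio x 0 = 1"
  by (simp add: odd_ratio_def)

lemma odd_ratio_Suc: "odd_ratio x (Suc m) = odd_ratio x m * ((1 - x ^ (2 * m + 1)) / (1 - x ^ (2 * m + 2)))"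
  by (simp add: odd_ratio_def qpoch_Suc power2_eq_square power_mult mult.assoc)

text \<open>Like \<open>node_diff\<close>, an analogue of the sum-to-product formulas for cosines:
  one factor depends on the difference \<open>d\<close> of the indices, the other on their sum
  \<open>2 * a + d\<close>. This splitting is what makes the products over pairs of nodes
  telescope.\<close>

lemma node_add:
  assumes "x \<noteq> 0"
  shows "node x (a + d) + node x a = (1 + x ^ d) * (1 + x ^ (2 * a + d)) / x ^ (a + d)"
  using assms by (simp add: node_def field_simps power_add mult_2_right)

lemma node_diff:
  assumes "x \<noteq> 0"
  shows "node x (a + d) - node x a = (1 - x ^ d) * (1 - x ^ (2 * a + d)) / x ^ (a + d)"
  using assms by (simp add: node_def field_simps power_add mult_2_right)

text \<open>The evaluation point 2 is the node of index 0, so the difference and the sum of the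
  indices coincide and a square appears.\<close>

lemma two_minus_node:
  assumes "x \<noteq> 0"
  shows "2 - node x a = - ((1 - x ^ a)\<^sup>2 / x ^ a)"
  using assms by (simp add: node_def field_simps power2_eq_square)

lemma two_plus_node:
  assumes "x \<noteq> 0"
  shows "2 + node x a = (1 + x ^ a)\<^sup>2 / x ^ a"
  using assms by (simp add: node_def field_simps power2_eq_square)

context
  fixes x :: complex
  assumes x: "x \<noteq> 0" "norm x < 1"
begin

lemma one_minus_power_nonzero [simp]: "m > 0 \<Longrightarrow> 1 - x ^ m \<noteq> 0"
  using power_neq_one_complex(1)[OF x(2), of m] by simp

lemma one_plus_power_nonzero [simp]: "m > 0 \<Longrightarrow> 1 + x ^ m \<noteq> 0"
  using power_neq_one_complex(2)[OF x(2), of m] by (metis add_eq_0_iff)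

lemma node_neq:
  assumes "a < b" "a + b > 0"
  shows "node x b \<noteq> node x a"
proof -
  have "node x (a + (b - a)) - node x a \<noteq> 0"
    using assms x(1) power_neq_one_complex(1)[OF x(2)] unfolding node_diff[OF x(1)] by fastforce
  then show ?thesis
    using assms by simp
qed

lemma inj_node: "inj_on (\<lambda>i. node x (2 * i + 1)) {..<n}"
proof (rule linorder_inj_onI)
  fix i j :: nat assume "i < j"
  then show "node x (2 * i + 1) \<noteq> node x (2 * j + 1)"
    using node_neq[of "2 * i + 1" "2 * j + 1"] by simp
qed auto

text \<open>With \<open>k = j + d\<close>, the two factors on the right are the steps of
  \<open>plus_ratio\<close> to the indices \<open>k - j\<close> and
  \<open>k + j + 1\<close>.\<close>

lemma plus_factor_less:
  "(node x (2 * (j + d) + 1) + node x (2 * j + 1)) / (node x (2 * (j + d) + 1) - node x (2 * j + 1)) =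
    ((1 + x ^ (2 * d)) / (1 - x ^ (2 * d))) * ((1 + x ^ (2 * (2 * j + d + 1))) / (1 - x ^ (2 * (2 * j + d + 1))))"
proof -
  have e: "2 * (j + d) + 1 = (2 * j + 1) + 2 * d" "2 * (2 * j + 1) + 2 * d = 2 * (2 * j + d + 1)"
    by simp_all
  show ?thesis
    unfolding e(1) node_add[OF x(1)] node_diff[OF x(1)] e(2) using x(1) by simp
qed

text \<open>For \<open>j < m\<close> the indices \<open>k - j\<close> and \<open>k + j + 1\<close>
  together run once through \<open>k - m + 1\<close> to \<open>k + m\<close>, so the product
  telescopes.\<close>

lemma plus_product_less:
  "m \<le> k \<Longrightarrow> (\<Prod>j<m. (node x (2 * k + 1) + node x (2 * j + 1)) / (node x (2 * k + 1) - node x (2 * j + 1))) *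
    plus_ratio x (k - m) = plus_ratio x (k + m)"
proof (induction m)
  case (Suc m)
  define d where "d = k - Suc m"
  have d: "k = m + Suc d" "k - m = Suc d" "k - Suc m = d"
    using Suc.prems by (simp_all add: d_def)
  have "k + Suc m = Suc (k + m)" "2 * m + Suc d + 1 = Suc (k + m)"
    using d by simp_all
  moreover have "P * f * a = b * s" if "P * (a * r) = b" "f = r * s" for P a r b f s :: complex
    using that by (auto simp: mult_ac)
  ultimately show ?case
    using Suc.IH Suc.prems plus_factor_less[of m "Suc d"]
    by (simp only: prod.lessThan_Suc d(2,3) plus_ratio_Suc Suc_leD flip: d(1))
qed simp

text \<open>The factors with \<open>j < k\<close> give \<open>plus_ratio x (2 * k)\<close>. Those
  with \<open>j > k\<close> each bring a minus sign and contribute the indices \<open>1\<close> to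
  \<open>m\<close> and \<open>2 * k + 2\<close> to \<open>2 * k + m + 1\<close>. The skipped index
  \<open>2 * k + 1\<close> is compensated by the last quotient.\<close>

lemma plus_product:
  "(\<Prod>j\<in>{..<Suc (k + m)} - {k}. (node x (2 * k + 1) + node x (2 * j + 1)) / (node x (2 * k + 1) - node x (2 * j + 1))) =
    (-1) ^ m * plus_ratio x m * plus_ratio x (Suc (k + m) + k) * ((1 - x ^ (4 * k + 2)) / (1 + x ^ (4 * k + 2)))"
proof (induction m)
  case 0
  have i: "{..<Suc k} - {k} = {..<k}" by auto
  have e: "2 * Suc (k + k) = 4 * k + 2" by simp
  have key: "a = (-1) ^ 0 * plus_ratio x 0 * (a * (c / b)) * (b / c)" if "b \<noteq> 0" "c \<noteq> 0" for a b c
    using that by simp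
  have nz: "1 - x ^ (4 * k + 2) \<noteq> 0" "1 + x ^ (4 * k + 2) \<noteq> 0"
    by (rule one_minus_power_nonzero one_plus_power_nonzero, simp)+
  have p: "(\<Prod>j<k. (node x (2 * k + 1) + node x (2 * j + 1)) / (node x (2 * k + 1) - node x (2 * j + 1))) =
      plus_ratio x (k + k)"
    using plus_product_less[of k k] by simp
  show ?case
    unfolding add_0_right add_Suc plus_ratio_Suc[of x "k + k"] i e p by (rule key[OF nz])
next
  case (Suc m)
  let ?f = "\<lambda>j. (node x (2 * k + 1) + node x (2 * j + 1)) / (node x (2 * k + 1) - node x (2 * j + 1))"
  have "{..<Suc (k + Suc m)} - {k} = insert (k + Suc m) ({..<Suc (k + m)} - {k})"
    by auto
  then have f: "prod ?f ({..<Suc (k + Suc m)} - {k}) = ?f (k + Suc m) * prod ?f ({..<Suc (k + m)} - {k})"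
    by simp
  have g: "?f (k + Suc m) = - (((1 + x ^ (2 * Suc m)) / (1 - x ^ (2 * Suc m))) *
      ((1 + x ^ (2 * Suc (Suc (k + m) + k))) / (1 - x ^ (2 * Suc (Suc (k + m) + k)))))"
  proof -
    have e: "2 * k + Suc m + 1 = Suc (Suc (k + m) + k)" by simp
    have "?f (k + Suc m) = - ((node x (2 * (k + Suc m) + 1) + node x (2 * k + 1)) / (node x (2 * (k + Suc m) + 1) - node x (2 * k + 1)))"
      by (simp only: add.commute[of "node x (2 * k + 1)"] minus_divide_right minus_diff_eq)
    then show ?thesis
      unfolding plus_factor_less e .
  qed
  have e: "Suc (k + Suc m) + k = Suc (Suc (k + m) + k)" by simp
  have key: "f * P = (-1) ^ Suc m * (a * r) * (b * s) * z"
    if "P = (-1) ^ m * a * b * z" "f = - (r * s)" for f P a b r s z :: complex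
    using that by simp
  show ?case
    unfolding f e plus_ratio_Suc by (rule key[OF Suc.IH g])
qed

text \<open>Below \<open>k\<close>, the odd node \<open>2 * j + 1\<close> is paired with the even
  node after it. Both differences then carry the same power of \<open>x\<close>, which
  cancels.\<close>

lemma odd_factor_less:
  "(node x (2 * (j + Suc d) + 1) - node x (2 * Suc j)) / (node x (2 * (j + Suc d) + 1) - node x (2 * j + 1)) =
    ((1 - x ^ (2 * d + 1)) / (1 - x ^ (2 * d + 2))) *
    ((1 - x ^ (2 * (2 * j + Suc d + 1) + 1)) / (1 - x ^ (2 * (2 * j + Suc d) + 2)))"
proof -
  have e: "2 * (j + Suc d) + 1 = 2 * Suc j + (2 * d + 1)" "2 * (2 * Suc j) + (2 * d + 1) = 2 * (2 * j + Suc d + 1) + 1"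
    and e': "2 * (j + Suc d) + 1 = (2 * j + 1) + (2 * d + 2)" "2 * (2 * j + 1) + (2 * d + 2) = 2 * (2 * j + Suc d) + 2"
    by simp_all
  have "node x (2 * (j + Suc d) + 1) - node x (2 * Suc j) =
      (1 - x ^ (2 * d + 1)) * (1 - x ^ (2 * (2 * j + Suc d + 1) + 1)) / x ^ (2 * (j + Suc d) + 1)"
    using node_diff[OF x(1), of "2 * Suc j" "2 * d + 1"] unfolding e(2) e(1)[symmetric] .
  moreover have "node x (2 * (j + Suc d) + 1) - node x (2 * j + 1) =
      (1 - x ^ (2 * d + 2)) * (1 - x ^ (2 * (2 * j + Suc d) + 2)) / x ^ (2 * (j + Suc d) + 1)"
    using node_diff[OF x(1), of "2 * j + 1" "2 * d + 2"] unfolding e'(2) e'(1)[symmetric] .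
  ultimately show ?thesis
    using x(1) by simp
qed

text \<open>Above \<open>k\<close>, an odd node is paired with the even node before it. The powers
  of \<open>x\<close> from \<open>node_diff\<close> now differ by one, which leaves the factor
  \<open>x\<close>.\<close>

lemma odd_factor_greater:
  "(node x (2 * k + 1) - node x (2 * (k + Suc m))) / (node x (2 * k + 1) - node x (2 * (k + Suc m) + 1)) =
    x * ((1 - x ^ (2 * m + 1)) / (1 - x ^ (2 * m + 2))) *
    ((1 - x ^ (2 * (Suc (k + m) + k) + 1)) / (1 - x ^ (2 * (Suc (k + m) + k) + 2)))"
proof -
  have e: "2 * k + 1 + (2 * m + 1) = 2 * (k + Suc m)" "2 * (2 * k + 1) + (2 * m + 1) = 2 * (Suc (k + m) + k) + 1"
    and e': "2 * k + 1 + (2 * m + 2) = 2 * (k + Suc m) + 1" "2 * (2 * k + 1) + (2 * m + 2) = 2 * (Suc (k + m) + k) + 2"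
    by simp_all
  have "node x (2 * (k + Suc m)) - node x (2 * k + 1) =
      (1 - x ^ (2 * m + 1)) * (1 - x ^ (2 * (Suc (k + m) + k) + 1)) / x ^ (2 * (k + Suc m))"
    using node_diff[OF x(1), of "2 * k + 1" "2 * m + 1"] unfolding e .
  moreover have "node x (2 * (k + Suc m) + 1) - node x (2 * k + 1) =
      (1 - x ^ (2 * m + 2)) * (1 - x ^ (2 * (Suc (k + m) + k) + 2)) / (x * x ^ (2 * (k + Suc m)))"
    using node_diff[OF x(1), of "2 * k + 1" "2 * m + 2"] unfolding e' by simp
  moreover have "a / b / (c / (x * b)) = x * (a / c)" if "b \<noteq> 0" for a b c
    using that x(1) by simp
  ultimately have "(node x (2 * (k + Suc m)) - node x (2 * k + 1)) / (node x (2 * (k + Suc m) + 1) - node x (2 * k + 1)) =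
      x * ((1 - x ^ (2 * m + 1)) * (1 - x ^ (2 * (Suc (k + m) + k) + 1)) /
        ((1 - x ^ (2 * m + 2)) * (1 - x ^ (2 * (Suc (k + m) + k) + 2))))"
    using x(1) by (simp only:) simp
  then show ?thesis
    by (metis (no_types, lifting) minus_diff_eq minus_divide_divide mult.assoc times_divide_times_eq)
qed

text \<open>The factors governed by index differences give
  \<open>odd_ratio x k / odd_ratio x (k - m)\<close>. In those governed by index sums the numerators
  are shifted by one step, which accounts for the two extra end factors.\<close>

lemma odd_product_less:
  "m \<le> k \<Longrightarrow> (\<Prod>j<m. (node x (2 * k + 1) - node x (2 * Suc j)) / (node x (2 * k + 1) - node x (2 * j + 1))) *
    odd_ratio x (k - m) * (1 - x ^ (2 * k + 1)) = odd_ratio x (k + m) * (1 - x ^ (2 * (k + m) + 1))"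
proof (induction m)
  case (Suc m)
  define d where "d = k - Suc m"
  have d: "k = m + Suc d" "k - m = Suc d" "k - Suc m = d"
    using Suc.prems by (simp_all add: d_def)
  have e: "k + Suc m = Suc (k + m)" "2 * m + Suc d + 1 = Suc (k + m)" "2 * m + Suc d = k + m" "k + m + 1 = Suc (k + m)"
    using d by simp_all
  have key: "P * f * a * w = b * (v / g) * h" if "P * (a * r) * w = b * v" "f = r * (h / g)"
    for P f a w b v g h r :: complex
  proof -
    have "P * f * a * w = P * (a * r) * w * (h / g)"
      unfolding that(2) by simp
    then show ?thesis
      unfolding that(1) by simp
  qed
  have IH: "(\<Prod>j<m. (node x (2 * k + 1) - node x (2 * Suc j)) / (node x (2 * k + 1) - node x (2 * j + 1))) *
      (odd_ratio x d * ((1 - x ^ (2 * d + 1)) / (1 - x ^ (2 * d + 2)))) * (1 - x ^ (2 * k + 1)) =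
      odd_ratio x (k + m) * (1 - x ^ (2 * (k + m) + 1))"
    using Suc.IH[OF Suc_leD[OF Suc.prems]] unfolding d(2) odd_ratio_Suc .
  have f: "(node x (2 * k + 1) - node x (2 * Suc m)) / (node x (2 * k + 1) - node x (2 * m + 1)) =
      ((1 - x ^ (2 * d + 1)) / (1 - x ^ (2 * d + 2))) *
      ((1 - x ^ (2 * Suc (k + m) + 1)) / (1 - x ^ (2 * (k + m) + 2)))"
    using odd_factor_less[of m d] unfolding d(1)[symmetric] e .
  show ?case
    unfolding prod.lessThan_Suc d(3) e(1) odd_ratio_Suc by (rule key[OF IH f])
qed simp

text \<open>The pairing switches at \<open>k\<close>, so that the \<open>k + m\<close> even nodes
  match the odd nodes other than the one of \<open>k\<close>; each of the \<open>m\<close> pairs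
  above \<open>k\<close> contributes one \<open>x\<close>.\<close>

lemma odd_product:
  "(\<Prod>j<k + m. node x (2 * k + 1) - node x (2 * Suc j)) /
    (\<Prod>j\<in>{..<Suc (k + m)} - {k}. node x (2 * k + 1) - node x (2 * j + 1)) =
    x ^ m * odd_ratio x m * odd_ratio x (Suc (k + m) + k) * (1 + x ^ (2 * k + 1))"
proof (induction m)
  case 0
  have i: "{..<Suc k} - {k} = {..<k}" by auto
  have "1 - a\<^sup>2 = (1 - a) * (1 + a)" for a :: complex
    by (simp add: algebra_simps power2_eq_square)
  moreover have "x ^ (2 * (k + k) + 2) = (x ^ (2 * k + 1))\<^sup>2"
    unfolding power_mult[symmetric] by (rule arg_cong[of _ _ "power x"]) simp
  \<comment> \<open>This is the new denominator in the step of \<open>odd_ratio\<close> from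
    \<open>2 * k\<close> to \<open>2 * k + 1\<close>. Its first factor matches the end factor of
    \<open>odd_product_less\<close>; the second remains as
    \<open>1 + x ^ (2 * k + 1)\<close>.\<close>
  ultimately have e: "1 - x ^ (2 * (k + k) + 2) = (1 - x ^ (2 * k + 1)) * (1 + x ^ (2 * k + 1))"
    by simp
  have key: "P = x ^ 0 * odd_ratio x 0 * (b * (g / (v * t))) * t" if "P * odd_ratio x 0 * v = b * g" "v \<noteq> 0" "t \<noteq> 0" for P b g v t
    using that by (simp add: field_simps)
  have nz: "1 - x ^ (2 * k + 1) \<noteq> 0" "1 + x ^ (2 * k + 1) \<noteq> 0"
    by (rule one_minus_power_nonzero one_plus_power_nonzero, simp)+
  show ?case
    unfolding add_0_right add_Suc odd_ratio_Suc[of x "k + k"] i e prod_dividef[symmetric]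
    by (rule key[OF odd_product_less[OF order_refl, unfolded diff_self_eq_0] nz])
next
  case (Suc m)
  let ?D = "\<lambda>j. node x (2 * k + 1) - node x (2 * j + 1)"
  have "{..<Suc (k + Suc m)} - {k} = insert (k + Suc m) ({..<Suc (k + m)} - {k})"
    by auto
  then have D: "prod ?D ({..<Suc (k + Suc m)} - {k}) = ?D (k + Suc m) * prod ?D ({..<Suc (k + m)} - {k})"
    by simp
  have N: "(\<Prod>j<k + Suc m. node x (2 * k + 1) - node x (2 * Suc j)) =
      (\<Prod>j<k + m. node x (2 * k + 1) - node x (2 * Suc j)) * (node x (2 * k + 1) - node x (2 * (k + Suc m)))"
    by simp
  have key: "a * b / (c * d) = x ^ Suc m * (v * s) * (w * t) * z"
    if "a / d = x ^ m * v * w * z" "b / c = x * s * t" for a b c d v w s t z :: complex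
  proof -
    have "a * b / (c * d) = (a / d) * (b / c)"
      by simp
    then show ?thesis
      unfolding that by (simp add: mult_ac)
  qed
  have e: "Suc (k + Suc m) + k = Suc (Suc (k + m) + k)"
    by simp
  show ?case
    unfolding D N e odd_ratio_Suc by (rule key[OF Suc.IH odd_factor_greater])
qed

end

subsection \<open>Finite identities\<close>

text \<open>Logarithmic differentiation, with each derivative given as \<open>g i w * d i\<close> so
  that no division by \<open>g i w\<close> occurs.\<close>

lemma has_field_derivative_prod_log:
  fixes g :: "nat \<Rightarrow> 'a::real_normed_field \<Rightarrow> 'a"
  assumes "\<And>i. i < n \<Longrightarrow> (g i has_field_derivative g i w * d i) (at w)"
  shows "((\<lambda>w. \<Prod>i<n. g i w) has_field_derivative (\<Prod>i<n. g i w) * (\<Sum>i<n. d i)) (at w)"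
  using assms
proof (induction n)
  case (Suc n)
  have "((\<lambda>w. (\<Prod>i<n. g i w) * g n w) has_field_derivative
      (\<Prod>i<n. g i w) * (\<Sum>i<n. d i) * g n w + g n w * d n * (\<Prod>i<n. g i w)) (at w)"
    using Suc by (intro DERIV_mult) auto
  then show ?case
    by (simp add: algebra_simps)
qed simp

context
  fixes x :: complex
  assumes x: "x \<noteq> 0" "norm x < 1"
begin

lemma node_neq_2:
  assumes "m > 0"
  shows "node x m \<noteq> 2"
proof -
  have "2 - node x m \<noteq> 0"
    unfolding two_minus_node[OF x(1)] using x(1) one_minus_power_nonzero[OF x assms] by simp
  then show ?thesis
    by auto
qed

lemma plus_prod_at_2:
  "(\<Prod>i<n. (2 + node x (2 * i + 1)) / (2 - node x (2 * i + 1))) =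
    (-1) ^ n * (qpoch (- x) (x\<^sup>2) n / qpoch x (x\<^sup>2) n)\<^sup>2"
proof (induction n)
  case (Suc n)
  have "(2 + node x (2 * n + 1)) / (2 - node x (2 * n + 1)) = - ((1 + x ^ (2 * n + 1)) / (1 - x ^ (2 * n + 1)))\<^sup>2"
    unfolding two_minus_node[OF x(1)] two_plus_node[OF x(1)] using x(1) by (simp add: power_divide)
  moreover have "- x * (x\<^sup>2) ^ n = - (x ^ (2 * n + 1))" "x * (x\<^sup>2) ^ n = x ^ (2 * n + 1)"
    by (simp_all add: power_mult)
  ultimately show ?case
    unfolding prod.lessThan_Suc Suc.IH qpoch_Suc by (simp only: diff_minus_eq_add) (simp add: power_mult_distrib power_divide)
qed simp

text \<open>For \<open>y = x ^ (2 * k + 1)\<close> this produces the summand of the theorem: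
  \<open>1 + y\<^sup>2\<close> cancels against the numerator of the node, and the square of 2 minus
  the node supplies \<open>(1 - y) ^ 4\<close>, of which one power cancels.\<close>

lemma node_coefficient:
  fixes y S :: complex
  assumes "y \<noteq> 0" "1 - y \<noteq> 0" "1 + y\<^sup>2 \<noteq> 0"
  shows "2 * (y + inverse y) * (S * ((1 - y\<^sup>2) / (1 + y\<^sup>2))) / (2 - (y + inverse y))\<^sup>2 = 2 * S * (y * (1 + y) / (1 - y) ^ 3)"
proof -
  have 1: "y + inverse y = (1 + y\<^sup>2) / y"
    using assms by (simp add: field_simps power2_eq_square)
  have 2: "2 - (y + inverse y) = - ((1 - y)\<^sup>2 / y)"
    using assms by (simp add: field_simps power2_eq_square)
  have 3: "1 - y\<^sup>2 = (1 - y) * (1 + y)"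
    by (simp add: algebra_simps power2_eq_square)
  have 4: "2 * (c / y) * (S * ((d * e) / c)) / (- (d\<^sup>2 / y))\<^sup>2 = 2 * S * (y * e / d ^ 3)"
    if "c \<noteq> 0" "d \<noteq> 0" for c d e
    using that assms(1) by (simp add: field_simps power2_eq_square power3_eq_cube)
  show ?thesis
    unfolding 2 unfolding 1 3 using assms by (intro 4)
qed

text \<open>With \<open>u = y + inverse y\<close>, the logarithmic derivative at 2 is
  \<open>- 2 * u / (4 - u\<^sup>2)\<close>, and \<open>4 - u\<^sup>2\<close> is minus the square of
  \<open>(1 - y\<^sup>2) / y\<close>.\<close>

lemma node_quotient_derivative:
  fixes y :: complex
  assumes "y \<noteq> 0" "1 - y \<noteq> 0" "1 + y \<noteq> 0"
  shows "((\<lambda>w. (w + (y + inverse y)) / (w - (y + inverse y))) has_field_derivative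
    (2 + (y + inverse y)) / (2 - (y + inverse y)) * (2 * y * (1 + y\<^sup>2) / (1 - y\<^sup>2)\<^sup>2)) (at 2)"
proof -
  define u where "u = y + inverse y"
  have 1: "u = (1 + y\<^sup>2) / y"
    using assms by (simp add: u_def field_simps power2_eq_square)
  have 2: "2 - u = - ((1 - y)\<^sup>2 / y)" "2 + u = (1 + y)\<^sup>2 / y"
    using assms by (simp_all add: u_def field_simps power2_eq_square)
  have 3: "1 - y\<^sup>2 = (1 - y) * (1 + y)"
    by (simp add: algebra_simps power2_eq_square)
  have "2 - u \<noteq> 0"
    unfolding 2 using assms by simp
  then have "((\<lambda>w. (w + u) / (w - u)) has_field_derivative - (2 * u) / (2 - u)\<^sup>2) (at 2)"
    by (auto intro!: derivative_eq_intros simp: power2_eq_square)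
  moreover have "- (2 * (c / y)) / (- (d\<^sup>2 / y))\<^sup>2 = e\<^sup>2 / y / (- (d\<^sup>2 / y)) * (2 * y * c / (d * e)\<^sup>2)"
    if "e \<noteq> 0" "d \<noteq> 0" for c d e
    using that assms(1) by (simp add: field_simps power2_eq_square)
  then have "- (2 * u) / (2 - u)\<^sup>2 = (2 + u) / (2 - u) * (2 * y * (1 + y\<^sup>2) / (1 - y\<^sup>2)\<^sup>2)"
    unfolding 2 unfolding 1 3 using assms by blast
  ultimately show ?thesis
    by (simp add: u_def)
qed

lemma alternating_sum_finite:
  "(\<Sum>k<n. plus_ratio x (n - 1 - k) * plus_ratio x (n + k) *
      ((-1) ^ k * (x ^ (2 * k) * (1 + x ^ (2 * k + 1)) / (1 - x ^ (2 * k + 1)) ^ 3))) =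
    (qpoch (- x) (x\<^sup>2) n / qpoch x (x\<^sup>2) n)\<^sup>2 *
      (\<Sum>k<n. x ^ (2 * k) * (1 + (x ^ (2 * k + 1))\<^sup>2) / (1 - (x ^ (2 * k + 1))\<^sup>2)\<^sup>2)"
  (is "(\<Sum>k<n. ?t k) = ?Q\<^sup>2 * (\<Sum>k<n. ?s k)")
proof -
  define u where "u i = node x (2 * i + 1)" for i
  define p where "p = (\<Prod>i<n. [:u i, 1:])"
  define c where "c k = poly p (u k) / (\<Prod>i\<in>{..<n} - {k}. u k - u i)" for k
  have deg: "degree p = n"
    unfolding p_def by (subst degree_prod_eq_sum_degree) auto
  have lead: "coeff p n = 1"
    using deg lead_coeff_prod[of "\<lambda>i. [:u i, 1:]" "{..<n}"] by (simp add: p_def)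
  have poly_p: "poly p w = (\<Prod>i<n. w + u i)" for w
    by (simp add: p_def poly_prod add.commute)
  have inj: "inj_on u {..<n}"
    using inj_node[OF x] by (simp add: u_def[abs_def])
  \<comment> \<open>The constant 1 is the leading coefficient of \<open>p\<close>, whose degree
    equals the number of nodes.\<close>
  have expand: "1 + (\<Sum>k<n. c k / (w - u k)) = (\<Prod>i<n. (w + u i) / (w - u i))" if "w \<in> - u ` {..<n}" for w
  proof -
    have "w \<noteq> u k" if "k < n" for k
      using that \<open>w \<in> _\<close> by auto
    from poly_partial_fractions[OF inj eq_imp_le[OF deg] this] show ?thesis
      by (simp add: lead poly_p prod_dividef c_def)
  qed
  have not2: "u k \<noteq> 2" for k
    using node_neq_2 by (simp add: u_def)
  have y: "x ^ (2 * k + 1) \<noteq> 0" "1 - x ^ (2 * k + 1) \<noteq> 0" "1 + x ^ (2 * k + 1) \<noteq> 0" "1 + (x ^ (2 * k + 1))\<^sup>2 \<noteq> 0" for k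
    using x(1) one_minus_power_nonzero[OF x, of "2 * k + 1"] one_plus_power_nonzero[OF x, of "2 * k + 1"]
      one_plus_power_nonzero[OF x, of "(2 * k + 1) * 2"] unfolding power_mult[symmetric] by simp_all
  have D1: "((\<lambda>w. \<Prod>i<n. (w + u i) / (w - u i)) has_field_derivative
      (\<Prod>i<n. (2 + u i) / (2 - u i)) * (\<Sum>k<n. 2 * x ^ (2 * k + 1) * (1 + (x ^ (2 * k + 1))\<^sup>2) / (1 - (x ^ (2 * k + 1))\<^sup>2)\<^sup>2)) (at 2)"
    unfolding u_def node_def by (intro has_field_derivative_prod_log node_quotient_derivative y)
  have "((\<lambda>w. 1 + (\<Sum>k<n. c k / (w - u k))) has_field_derivative 0 + (\<Sum>k<n. - (c k / (2 - u k)\<^sup>2))) (at 2)"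
    by (intro DERIV_add DERIV_const DERIV_sum)
       (use not2 in \<open>auto intro!: derivative_eq_intros simp: power2_eq_square\<close>)
  then have D0: "((\<lambda>w. 1 + (\<Sum>k<n. c k / (w - u k))) has_field_derivative (\<Sum>k<n. - (c k / (2 - u k)\<^sup>2))) (at 2)"
    by (simp only: add_0_left)
  \<comment> \<open>The two functions are identified only away from the nodes, an open set
    containing 2, so the derivative is transferred there.\<close>
  have D2: "((\<lambda>w. \<Prod>i<n. (w + u i) / (w - u i)) has_field_derivative (\<Sum>k<n. - (c k / (2 - u k)\<^sup>2))) (at 2)"
  proof (rule has_field_derivative_transform_within_open[OF D0])
    show "open (- u ` {..<n})"
      by (intro open_Compl finite_imp_closed) simp
    show "2 \<in> - u ` {..<n}"
      using not2 by (metis ComplI imageE)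
  qed (rule expand)
  have t: "- (c k / (2 - u k)\<^sup>2) = (-1) ^ n * (2 * x) * ?t k" if k: "k < n" for k
  proof -
    obtain m where n: "n = Suc (k + m)"
      using k less_iff_Suc_add by auto
    define S where "S = (-1) ^ m * plus_ratio x m * plus_ratio x (n + k)"
    \<comment> \<open>The numerator \<open>poly p (u k)\<close> includes the factor
      \<open>j = k\<close>, which the denominator omits.\<close>
    have "c k = (u k + u k) * (\<Prod>j\<in>{..<n} - {k}. (u k + u j) / (u k - u j))"
      using k by (simp add: c_def poly_p prod.remove[of _ k] prod_dividef)
    also have "(\<Prod>j\<in>{..<n} - {k}. (u k + u j) / (u k - u j)) = S * ((1 - x ^ (4 * k + 2)) / (1 + x ^ (4 * k + 2)))"
      unfolding u_def n S_def by (rule plus_product[OF x])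
    also have "x ^ (4 * k + 2) = (x ^ (2 * k + 1))\<^sup>2"
      unfolding power_mult[symmetric] by (rule arg_cong[of _ _ "power x"]) simp
    finally have "c k / (2 - u k)\<^sup>2 = 2 * S * (x ^ (2 * k + 1) * (1 + x ^ (2 * k + 1)) / (1 - x ^ (2 * k + 1)) ^ 3)"
      unfolding u_def node_def mult_2[symmetric] using node_coefficient[OF y(1,2,4)] by simp
    \<comment> \<open>Parity of \<open>n + k = 2 * k + m + 1\<close>.\<close>
    moreover have "(-1) ^ n * (-1) ^ k = - ((-1) ^ m :: complex)"
      unfolding n by (simp add: power_add flip: power_mult_distrib)
    moreover have "- (2 * (M * a * b) * (x * X * r / d)) = N * (2 * x) * (a * b * (K * (X * r / d)))"
      if "N * K = - M" for M N K a b X r d :: complex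
    proof -
      have "N * (2 * x) * (a * b * (K * (X * r / d))) = 2 * ((N * K) * a * b) * (x * X * r / d)"
        by simp
      then show ?thesis
        unfolding that by simp
    qed
    moreover have "n - 1 - k = m" "x ^ (2 * k + 1) = x * x ^ (2 * k)"
      using n by simp_all
    ultimately show ?thesis
      by (simp only: S_def)
  qed
  \<comment> \<open>Two expressions for the same derivative at 2 are compared;
    \<open>(-1) ^ n * (2 * x)\<close> occurs on both sides and is cancelled at the end.\<close>
  have "(-1) ^ n * (2 * x) * (\<Sum>k<n. ?t k) = (\<Sum>k<n. - (c k / (2 - u k)\<^sup>2))"
    unfolding sum_distrib_left by (intro sum.cong refl t[symmetric]) simp
  also have "\<dots> = (\<Prod>i<n. (2 + u i) / (2 - u i)) * (\<Sum>k<n. 2 * x ^ (2 * k + 1) * (1 + (x ^ (2 * k + 1))\<^sup>2) / (1 - (x ^ (2 * k + 1))\<^sup>2)\<^sup>2)"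
    by (rule DERIV_unique[OF D2 D1])
  also have "\<dots> = ((-1) ^ n * ?Q\<^sup>2) * (2 * x * (\<Sum>k<n. ?s k))"
    unfolding u_def plus_prod_at_2 sum_distrib_left
    by (intro arg_cong2[of _ _ _ _ "(*)"] sum.cong refl) simp
  finally have "((-1) ^ n * (2 * x)) * (\<Sum>k<n. ?t k) = ((-1) ^ n * (2 * x)) * (?Q\<^sup>2 * (\<Sum>k<n. ?s k))"
    by (simp only: mult_ac)
  then show ?thesis
    using x(1) by (subst (asm) mult_cancel_left) simp
qed

text \<open>By \<open>two_minus_node\<close> every factor is minus a square over a power of
  \<open>x\<close>. The surplus denominator factor leaves one sign, and the exponents add up to
  \<open>(n + 1)\<^sup>2 - n * (n + 1) = n + 1\<close>.\<close>

lemma odd_prod_at_2: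
  "(\<Prod>j<n. 2 - node x (2 * Suc j)) / (\<Prod>i<Suc n. 2 - node x (2 * i + 1)) =
    - (x ^ Suc n * (qpoch (x\<^sup>2) (x\<^sup>2) n / qpoch x (x\<^sup>2) (Suc n))\<^sup>2)"
proof (induction n)
  case 0
  show ?case
    using two_minus_node[OF x(1), of 1] x(1) by (simp add: qpoch_Suc power_divide)
next
  case (Suc n)
  have e: "x\<^sup>2 * (x\<^sup>2) ^ n = x ^ (2 * Suc n)" "x * (x\<^sup>2) ^ Suc n = x ^ (2 * Suc n + 1)"
    by (simp_all add: power_mult power2_eq_square)
  have Q: "qpoch (x\<^sup>2) (x\<^sup>2) (Suc n) = qpoch (x\<^sup>2) (x\<^sup>2) n * (1 - x ^ (2 * Suc n))"
    "qpoch x (x\<^sup>2) (Suc (Suc n)) = qpoch x (x\<^sup>2) (Suc n) * (1 - x ^ (2 * Suc n + 1))"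
    unfolding e[symmetric] by (rule qpoch_Suc)+
  have p: "x ^ (2 * Suc n + 1) = x * x ^ (2 * Suc n)"
    by simp
  have f: "(2 - node x (2 * Suc n)) / (2 - node x (2 * Suc n + 1)) =
      x * ((1 - x ^ (2 * Suc n)) / (1 - x ^ (2 * Suc n + 1)))\<^sup>2"
    unfolding two_minus_node[OF x(1)] using x(1) by (subst (2) p) (simp add: power_divide del: power_Suc mult_Suc_right)
  have key: "a * b / (c * d) = - (x ^ Suc (Suc n) * (g * r / (h * s))\<^sup>2)"
    if "a / c = - (x ^ Suc n * (g / h)\<^sup>2)" "b / d = x * (r / s)\<^sup>2" for a b c d g h r s :: complex
  proof -
    have "a * b / (c * d) = (a / c) * (b / d)"
      by simp
    then show ?thesis
      unfolding that by (simp add: power_mult_distrib power_divide)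
  qed
  show ?case
    unfolding Q prod.lessThan_Suc[of _ "Suc n"] prod.lessThan_Suc[of "\<lambda>j. 2 - node x (2 * Suc j)" n]
    by (rule key[OF Suc.IH f])
qed

lemma lambert_sum_finite:
  "(\<Sum>k<Suc n. odd_ratio x (Suc n - 1 - k) * odd_ratio x (Suc n + k) *
      (x ^ k * (1 + x ^ (2 * k + 1)) / (1 - x ^ (2 * k + 1))\<^sup>2)) =
    (qpoch (x\<^sup>2) (x\<^sup>2) n / qpoch x (x\<^sup>2) (Suc n))\<^sup>2"
  (is "(\<Sum>k<_. ?t k) = ?Q\<^sup>2")
proof -
  define u where "u i = node x (2 * i + 1)" for i
  define p where "p = (\<Prod>j<n. [:- node x (2 * Suc j), 1:])"
  have deg: "degree p = n"
    unfolding p_def by (subst degree_prod_eq_sum_degree) auto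
  have poly_p: "poly p w = (\<Prod>j<n. w - node x (2 * Suc j))" for w
    by (simp add: p_def poly_prod)
  have inj: "inj_on u {..<Suc n}"
    using inj_node[OF x] by (simp add: u_def[abs_def])
  have not2: "2 \<noteq> u k" for k
    using node_neq_2[of "2 * k + 1"] by (auto simp: u_def)
  have t: "poly p (u k) / (\<Prod>i\<in>{..<Suc n} - {k}. u k - u i) / (2 - u k) = - (x ^ Suc n) * ?t k" if k: "k < Suc n" for k
  proof -
    obtain m where n: "n = k + m"
      using k by (metis less_Suc_eq_le le_Suc_ex)
    have "poly p (u k) / (\<Prod>i\<in>{..<Suc n} - {k}. u k - u i) =
        x ^ m * odd_ratio x m * odd_ratio x (Suc n + k) * (1 + x ^ (2 * k + 1))"
      unfolding n poly_p u_def by (rule odd_product[OF x])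
    moreover have "2 - u k = - ((1 - x ^ (2 * k + 1))\<^sup>2 / x ^ (2 * k + 1))"
      unfolding u_def by (rule two_minus_node[OF x(1)])
    \<comment> \<open>The exponent \<open>m\<close> comes from \<open>odd_product\<close> and
      \<open>2 * k + 1\<close> from \<open>2 - u k\<close>. Splitting off the common
      \<open>x ^ Suc n\<close> leaves the \<open>x ^ k\<close> of the Lambert summand.\<close>
    moreover have "x ^ Suc n * x ^ k = x ^ m * x ^ (2 * k + 1)"
      unfolding n power_add[symmetric] by (rule arg_cong[of _ _ "power x"]) simp
    moreover have "Suc n - 1 - k = m"
      using n by simp
    moreover have "a * b * c * d / (- (e / f)) = - g * (b * c * (h * d / e))" if "g * h = a * f" for a b c d e f g h :: complex
    proof -
      have "a * b * c * d / (- (e / f)) = - (b * c * (a * f) * d / e)"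
        by simp
      also have "\<dots> = - g * (b * c * (h * d / e))"
        unfolding that[symmetric] by simp
      finally show ?thesis .
    qed
    ultimately show ?thesis
      by metis
  qed
  have "- (x ^ Suc n) * (\<Sum>k<Suc n. ?t k) = (\<Sum>k<Suc n. poly p (u k) / (\<Prod>i\<in>{..<Suc n} - {k}. u k - u i) / (2 - u k))"
    unfolding sum_distrib_left by (intro sum.cong refl t[symmetric]) simp
  \<comment> \<open>There are \<open>Suc n\<close> nodes but \<open>p\<close> has degree
    \<open>n\<close>, so the constant term vanishes.\<close>
  also have "\<dots> = poly p 2 / (\<Prod>i<Suc n. 2 - u i)"
    using poly_partial_fractions[OF inj, of p 2] deg not2 by (simp add: coeff_eq_0)
  also have "\<dots> = - (x ^ Suc n) * ?Q\<^sup>2"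
    unfolding poly_p u_def odd_prod_at_2 by simp
  finally show ?thesis
    using x(1) by (subst (asm) mult_cancel_left) simp
qed

end

subsection \<open>Limits\<close>

lemma qpoch_ratio_LIMSEQ:
  assumes "norm q < 1" "norm b < 1"
  shows "(\<lambda>n. qpoch a q n / qpoch b q n) \<longlonglongrightarrow> qpoch_inf a q / qpoch_inf b q"
  using assms by (intro tendsto_divide qpoch_LIMSEQ qpoch_inf_nonzero)

lemma odd_power_LIMSEQ_0:
  fixes x :: complex
  assumes "norm x < 1"
  shows "(\<lambda>k. x ^ (2 * k + 1)) \<longlonglongrightarrow> 0"
  using LIMSEQ_subseq_LIMSEQ[OF LIMSEQ_power_zero[OF assms], of "\<lambda>k. 2 * k + 1"]
  by (simp add: o_def strict_mono_def)

context
  fixes x :: complex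
  assumes x: "x \<noteq> 0" "norm x < 1"
begin

lemma norm_square: "norm (x\<^sup>2) < 1"
  using x(2) by (simp add: norm_power power_less_one_iff)

text \<open>The cofactor of the geometric term tends to 1 and is therefore bounded.\<close>

lemma summable_alternating:
  "summable (\<lambda>k. norm ((-1) ^ k * (x ^ (2 * k) * (1 + x ^ (2 * k + 1)) / (1 - x ^ (2 * k + 1)) ^ 3)))"
proof -
  have "(\<lambda>k. (1 + x ^ (2 * k + 1)) / (1 - x ^ (2 * k + 1)) ^ 3) \<longlonglongrightarrow> (1 + 0) / (1 - 0) ^ 3"
    by (intro tendsto_intros odd_power_LIMSEQ_0 x) auto
  then have "Bseq (\<lambda>k. (1 + x ^ (2 * k + 1)) / (1 - x ^ (2 * k + 1)) ^ 3)"
    by (intro convergent_imp_Bseq convergentI)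
  from summable_norm_power_mult[OF norm_square this] show ?thesis
    by (simp add: norm_mult norm_divide norm_power power_mult)
qed

lemma summable_lambert:
  "summable (\<lambda>k. norm (x ^ k * (1 + x ^ (2 * k + 1)) / (1 - x ^ (2 * k + 1))\<^sup>2))"
proof -
  have "(\<lambda>k. (1 + x ^ (2 * k + 1)) / (1 - x ^ (2 * k + 1))\<^sup>2) \<longlonglongrightarrow> (1 + 0) / (1 - 0)\<^sup>2"
    by (intro tendsto_intros odd_power_LIMSEQ_0 x) auto
  then have "Bseq (\<lambda>k. (1 + x ^ (2 * k + 1)) / (1 - x ^ (2 * k + 1))\<^sup>2)"
    by (intro convergent_imp_Bseq convergentI)
  from summable_norm_power_mult[OF x(2) this] show ?thesis
    by simp
qed

lemma lambert_sum_infinite: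
  "(\<Sum>k. x ^ k * (1 + x ^ (2 * k + 1)) / (1 - x ^ (2 * k + 1))\<^sup>2) =
    (qpoch_inf (x\<^sup>2) (x\<^sup>2) / qpoch_inf x (x\<^sup>2)) ^ 4"
  (is "suminf ?t = _")
proof -
  let ?o = "qpoch_inf x (x\<^sup>2)" and ?e = "qpoch_inf (x\<^sup>2) (x\<^sup>2)"
  have nz: "?o \<noteq> 0" "?e \<noteq> 0"
    using x(2) norm_square by (simp_all add: qpoch_inf_nonzero)
  have "odd_ratio x \<longlonglongrightarrow> ?o / ?e"
    unfolding odd_ratio_def[abs_def] using norm_square by (intro qpoch_ratio_LIMSEQ)
  from LIMSEQ_Suc[OF tannery_convolution[OF this summable_lambert]]
  have "(\<lambda>n. (qpoch (x\<^sup>2) (x\<^sup>2) n / qpoch x (x\<^sup>2) (Suc n))\<^sup>2) \<longlonglongrightarrow> (?o / ?e)\<^sup>2 * suminf ?t"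
    unfolding lambert_sum_finite[OF x] .
  moreover have "(\<lambda>n. (qpoch (x\<^sup>2) (x\<^sup>2) n / qpoch x (x\<^sup>2) (Suc n))\<^sup>2) \<longlonglongrightarrow> (?e / ?o)\<^sup>2"
    using norm_square nz by (intro tendsto_intros qpoch_LIMSEQ LIMSEQ_Suc[OF qpoch_LIMSEQ])
  \<comment> \<open>The weights tend to the square of \<open>?o / ?e\<close> and the closed form to
    the square of its inverse; dividing gives the fourth power.\<close>
  ultimately have "(?o / ?e)\<^sup>2 * suminf ?t = (?e / ?o)\<^sup>2"
    by (rule LIMSEQ_unique)
  then show ?thesis
    using nz by (simp add: field_simps power_divide flip: power_add)
qed

end

lemma alternating_sum_infinite:
  fixes x :: complex
  assumes x: "x \<noteq> 0" "norm x < 1"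
  shows "(qpoch_inf (- x\<^sup>2) (x\<^sup>2) / qpoch_inf (x\<^sup>2) (x\<^sup>2))\<^sup>2 *
      (\<Sum>k. (-1) ^ k * (x ^ (2 * k) * (1 + x ^ (2 * k + 1)) / (1 - x ^ (2 * k + 1)) ^ 3)) =
    (qpoch_inf (- x) (x\<^sup>2) / qpoch_inf x (x\<^sup>2))\<^sup>2 * (qpoch_inf (x ^ 4) (x ^ 4) / qpoch_inf (x\<^sup>2) (x ^ 4)) ^ 4"
  (is "?L\<^sup>2 * suminf ?t = ?R\<^sup>2 * ?S")
proof -
  let ?s = "\<lambda>k. (x\<^sup>2) ^ k * (1 + (x\<^sup>2) ^ (2 * k + 1)) / (1 - (x\<^sup>2) ^ (2 * k + 1))\<^sup>2"
  have x2: "x\<^sup>2 \<noteq> 0" "norm (x\<^sup>2) < 1"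
    using x norm_square[OF x] by simp_all
  \<comment> \<open>The sum from the logarithmic derivative is the Lambert sum with
    \<open>x\<^sup>2\<close> in place of \<open>x\<close>.\<close>
  have s: "x ^ (2 * k) * (1 + (x ^ (2 * k + 1))\<^sup>2) / (1 - (x ^ (2 * k + 1))\<^sup>2)\<^sup>2 = ?s k" for k
    unfolding power_mult[symmetric] by (simp add: algebra_simps)
  have "plus_ratio x \<longlonglongrightarrow> ?L"
    unfolding plus_ratio_def[abs_def] using x2 by (intro qpoch_ratio_LIMSEQ)
  from tannery_convolution[OF this summable_alternating[OF x]]
  have "(\<lambda>n. (qpoch (- x) (x\<^sup>2) n / qpoch x (x\<^sup>2) n)\<^sup>2 * (\<Sum>k<n. ?s k)) \<longlonglongrightarrow> ?L\<^sup>2 * suminf ?t"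
    unfolding alternating_sum_finite[OF x] s .
  moreover have "(\<lambda>n. (qpoch (- x) (x\<^sup>2) n / qpoch x (x\<^sup>2) n)\<^sup>2 * (\<Sum>k<n. ?s k)) \<longlonglongrightarrow> ?R\<^sup>2 * suminf ?s"
    using x x2
    by (intro tendsto_mult tendsto_power qpoch_ratio_LIMSEQ summable_LIMSEQ
        summable_norm_cancel[OF summable_lambert]) auto
  ultimately have "?L\<^sup>2 * suminf ?t = ?R\<^sup>2 * suminf ?s"
    by (rule LIMSEQ_unique)
  then show ?thesis
    unfolding lambert_sum_infinite[OF x2] by (simp flip: power_mult)
qed

theorem theorem1p1:
  fixes q :: complex
  assumes "norm q < 1"
  shows "(\<lambda>k. (-1) ^ k * (q ^ (2 * k) * (1 + q ^ (2 * k + 1)) / (1 - q ^ (2 * k + 1)) ^ 3)) sums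
    (qpoch_inf (q ^ 2) (q ^ 4) ^ 2 * qpoch_inf (q ^ 4) (q ^ 4) ^ 6 / qpoch_inf q (q ^ 2) ^ 4)"
  (is "?t sums ?r")
proof (cases "q = 0")
  case True
  \<comment> \<open>The nodes contain \<open>inverse\<close>, so \<open>q = 0\<close> is treated
    apart: by \<open>0 ^ 0 = 1\<close> only the term \<open>k = 0\<close> survives, and all products
    equal 1.\<close>
  have "?t k = (if k = 0 then 1 else 0)" for k
    using True by (simp add: power_0_left)
  moreover have "qpoch_inf 0 0 = 1"
    by (simp add: qpoch_inf_def)
  ultimately show ?thesis
    using sums_single[of 0 "\<lambda>_. 1 :: complex"] True by simp
next
  case False
  note q = False assms
  have q2: "norm (q\<^sup>2) < 1" and q4: "norm (q ^ 4) < 1"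
    using assms by (simp_all add: norm_power power_less_one_iff)
  have sq: "(q\<^sup>2)\<^sup>2 = q ^ 4"
    by simp
  \<comment> \<open>Every product in \<open>alternating_sum_infinite\<close> is a Laurent monomial
    in \<open>u\<close>, \<open>v\<close> and \<open>w\<close>.\<close>
  define u where "u = qpoch_inf q (q\<^sup>2)"
  define v where "v = qpoch_inf (q\<^sup>2) (q ^ 4)"
  define w where "w = qpoch_inf (q ^ 4) (q ^ 4)"
  have nz: "u \<noteq> 0" "v \<noteq> 0" "w \<noteq> 0"
    unfolding u_def v_def w_def using assms q2 q4 by (simp_all add: qpoch_inf_nonzero)
  have "u * qpoch_inf (- q) (q\<^sup>2) = v"
    using qpoch_inf_mult_uminus[OF q2, of q] unfolding sq u_def v_def .
  then have m: "qpoch_inf (- q) (q\<^sup>2) = v / u"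
    using nz by (simp add: field_simps)
  have b: "qpoch_inf (q\<^sup>2) (q\<^sup>2) = v * w"
    using qpoch_inf_bisect[OF q2] unfolding sq v_def w_def .
  have "qpoch_inf (q\<^sup>2) (q\<^sup>2) * qpoch_inf (- q\<^sup>2) (q\<^sup>2) = w"
    using qpoch_inf_mult_uminus[OF q2, of "q\<^sup>2"] unfolding sq w_def .
  \<comment> \<open>Euler's identity between distinct and odd parts, in base
    \<open>q\<^sup>2\<close>.\<close>
  then have mb: "qpoch_inf (- q\<^sup>2) (q\<^sup>2) = 1 / v"
    using nz by (simp add: b field_simps)
  have "(1 / v / (v * w))\<^sup>2 * suminf ?t = (v / u / u)\<^sup>2 * (w / v) ^ 4"
    using alternating_sum_infinite[OF q] unfolding m b mb u_def[symmetric] v_def[symmetric] w_def[symmetric] .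
  then have "suminf ?t = v\<^sup>2 * w ^ 6 / u ^ 4"
    using nz by (simp add: field_simps power2_eq_square eval_nat_numeral)
  then show ?thesis
    using summable_sums[OF summable_norm_cancel[OF summable_alternating[OF q]]]
    unfolding u_def v_def w_def by simp
qed

end
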